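(* For any constant $\epsilon>0$, there exists a randomized $(\epsilon n/\log n)$-approximation algorithm for XOS maximization in the value oracle model that runs in $O(n^{1/\epsilon+1}\log n)$ time. That is, for every XOS function $f\colon 2^V\to\mathbb{R}$ on a finite ground set $V$ of size $n\ge 2$ (with $\epsilon n/\log n\ge 1$) given by a value oracle, the algorithm returns a random set $\tilde X\subseteq V$ with $\mathbb{E}[f(\tilde X)]\ge \frac{\log n}{\epsilon n}\max_{X\subseteq V}f(X)$.
   Context: $\log$ is the natural logarithm. A set function $f\colon 2^V\to\mathbb{R}$ is additive if $f(X)=\sum_{v\in X}f(\{v\})$ for all $X\subseteq V$. It is XOS if there are finitely many additive functions $f_1,\dots,f_k\colon 2^V\to\mathbb{R}$ (values may be negative) such that $f(X)=\max_{i\in[k]}f_i(X)$ for all $X\subseteq V$; $f$ need not be monotone. XOS maximization: given an XOS function $f$ on $V$, $n=|V|$, accessible only through a value oracle (a query $X\subseteq V$ returns $f(X)$; the additive functions are not given), find $X\subseteq V$ maximizing $f(X)$. For $\alpha\ge1$, a randomized algorithm is an $\alpha$-approximation algorithm if the expected function value of its output is at least $\frac1\alpha\max_{X\subseteq V}f(X)$. Running time is measured by the number of value oracle calls, which asymptotically dominates the remaining computation. *)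

theory Defs
  imports "HOL-Probability.Probability" "HOL-Library.Landau_Symbols"
begin

text \<open>
  Set functions on a ground set \<open>V\<close> are total functions \<open>'a set \<Rightarrow> real\<close> of which only the values on
  subsets of \<open>V\<close> matter.
\<close>

definition additive_on :: "'a set \<Rightarrow> ('a set \<Rightarrow> real) \<Rightarrow> bool" where
  "additive_on V g \<longleftrightarrow> (\<forall>X\<subseteq>V. g X = (\<Sum>v\<in>X. g {v}))"

definition xos_on :: "'a set \<Rightarrow> ('a set \<Rightarrow> real) \<Rightarrow> bool" where
  "xos_on V f \<longleftrightarrow>
    (\<exists>F. finite F \<and> F \<noteq> {} \<and> (\<forall>g\<in>F. additive_on V g) \<and> (\<forall>X\<subseteq>V. f X = Max ((\<lambda>g. g X) ` F)))"

text \<open>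
  Randomized algorithms in the value oracle model: \<open>Query X c\<close> asks the oracle for the value of \<open>X\<close>
  and continues with \<open>c\<close> applied to the answer; \<open>Random m c\<close> draws a fresh number uniformly from
  \<open>{0, \<dots>, m}\<close> and continues with \<open>c\<close> applied to it.  The answers are all an algorithm learns about
  the function.  Elements of the datatype are well-founded trees, so every execution terminates.
\<close>

datatype ('a, 'r) oracle_alg =
  Return 'r
| Query "'a set" "real \<Rightarrow> ('a, 'r) oracle_alg"
| Random nat "nat \<Rightarrow> ('a, 'r) oracle_alg"

text \<open>
  Joint distribution of the output and the number of oracle calls when the oracle answers according
  to \<open>f\<close>.
\<close>

primrec run :: "('a set \<Rightarrow> real) \<Rightarrow> ('a, 'r) oracle_alg \<Rightarrow> ('r \<times> nat) pmf" where
  "run f (Return r) = return_pmf (r, 0)"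
| "run f (Query X c) = map_pmf (\<lambda>(r, t). (r, Suc t)) (run f (c (f X)))"
| "run f (Random m c) = bind_pmf (pmf_of_set {..m}) (\<lambda>i. run f (c i))"

definition output_pmf :: "('a set \<Rightarrow> real) \<Rightarrow> ('a, 'r) oracle_alg \<Rightarrow> 'r pmf" where
  "output_pmf f p = map_pmf fst (run f p)"

text \<open>Worst case over the random choices.\<close>

definition calls_at_most :: "('a set \<Rightarrow> real) \<Rightarrow> ('a, 'r) oracle_alg \<Rightarrow> nat \<Rightarrow> bool" where
  "calls_at_most f p T \<longleftrightarrow> (\<forall>(r, t) \<in> set_pmf (run f p). t \<le> T)"

text \<open>
  All queried sets and all outputs are subsets of \<open>V\<close>; in particular the irrelevant values of an
  oracle outside of \<open>V\<close> are never accessed.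
\<close>

primrec alg_on :: "'a set \<Rightarrow> ('a, 'a set) oracle_alg \<Rightarrow> bool" where
  "alg_on V (Return X) \<longleftrightarrow> X \<subseteq> V"
| "alg_on V (Query X c) \<longleftrightarrow> X \<subseteq> V \<and> (\<forall>y. alg_on V (c y))"
| "alg_on V (Random m c) \<longleftrightarrow> (\<forall>i\<le>m. alg_on V (c i))"

definition approximates :: "real \<Rightarrow> 'a set \<Rightarrow> ('a set \<Rightarrow> real) \<Rightarrow> ('a, 'a set) oracle_alg \<Rightarrow> bool" where
  "approximates \<alpha> V f p \<longleftrightarrow>
    measure_pmf.expectation (output_pmf f p) f \<ge> 1 / \<alpha> * Max (f ` Pow V)"

end

theory Submission
  imports Defs
begin

text \<open>
  Arrange \<open>V\<close> in a cycle and query all subsets of each of the \<open>n\<close> windows of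
  \<open>b = \<lceil>ln n / \<epsilon>\<rceil>\<close> cyclically consecutive elements, about \<open>n * 2 ^ b\<close> queries.  If the additive
  function \<open>w\<close> attains \<open>f\<close> at an optimal set \<open>M\<close>, then \<open>f (M \<inter> W) \<ge> w (M \<inter> W)\<close> for every window
  \<open>W\<close>.  Each element lies in exactly \<open>b\<close> windows, so the values \<open>w (M \<inter> W)\<close> sum to \<open>b * f M\<close> and
  some window yields at least \<open>(b / n) * f M\<close>.  Windows, as opposed to a partition into blocks,
  avoid rounding losses, and no randomness is needed.
\<close>

text \<open>The value \<open>y\<close> of the current best set is carried along instead of being
  queried again, so each list entry costs exactly one call.\<close>

primrec best_query :: "'a set \<Rightarrow> real \<Rightarrow> 'a set list \<Rightarrow> ('a, 'a set) oracle_alg" where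
  "best_query X y [] = Return X"
| "best_query X y (Q # Qs) =
    Query Q (\<lambda>z. if y < z then best_query Q z Qs else best_query X y Qs)"

lemma alg_on_best_query:
  assumes "X \<subseteq> V" "\<forall>Q\<in>set Qs. Q \<subseteq> V"
  shows "alg_on V (best_query X y Qs)"
  using assms by (induction Qs arbitrary: X y) auto

text \<open>No \<open>Random\<close> node occurs, so the run is a point mass. Starting from the true
  value \<open>f X\<close> keeps the recorded value correct whenever the best set changes, which is
  why the induction generalizes over \<open>X\<close>.\<close>

lemma run_best_query:
  "\<exists>R. run f (best_query X (f X) Qs) = return_pmf (R, length Qs) \<and>
       (\<forall>Q\<in>insert X (set Qs). f Q \<le> f R)"
proof (induction Qs arbitrary: X)
  case Nil
  then show ?case by auto
next
  case (Cons Q Qs)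
  show ?case
  proof (cases "f X < f Q")
    case True
    from Cons[of Q] obtain R where
      R: "run f (best_query Q (f Q) Qs) = return_pmf (R, length Qs)"
         "\<forall>P\<in>insert Q (set Qs). f P \<le> f R" by blast
    then show ?thesis using True by (intro exI[of _ R]) auto
  next
    case False
    from Cons[of X] obtain R where
      R: "run f (best_query X (f X) Qs) = return_pmf (R, length Qs)"
         "\<forall>P\<in>insert X (set Qs). f P \<le> f R" by blast
    then show ?thesis using False by (intro exI[of _ R]) auto
  qed
qed

lemma xos_on_empty:
  assumes "xos_on V f"
  shows "f {} = 0"
proof -
  from assms obtain F where F: "F \<noteq> {}" "\<forall>g\<in>F. additive_on V g"
      "f {} = Max ((\<lambda>g. g {}) ` F)"
    unfolding xos_on_def by blast
  have "(\<lambda>g. g {}) ` F = {0}"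
    using F(1,2) unfolding additive_on_def by force
  then show ?thesis using F(3) by simp
qed

text \<open>\<open>w\<close> consists of the singleton values of one additive function that attains
  the maximum of the family at \<open>M\<close>; as a member of the family it stays below
  \<open>f\<close> on every subset of \<open>V\<close>.\<close>

lemma xos_on_maximizer:
  assumes "finite V" "xos_on V f"
  obtains M w where "M \<subseteq> V" "Max (f ` Pow V) = sum w M" "\<And>X. X \<subseteq> V \<Longrightarrow> sum w X \<le> f X"
proof -
  from assms(2) obtain F where F: "finite F" "F \<noteq> {}" "\<And>g. g \<in> F \<Longrightarrow> additive_on V g"
      "\<And>X. X \<subseteq> V \<Longrightarrow> f X = Max ((\<lambda>g. g X) ` F)"
    unfolding xos_on_def by blast
  have "Max (f ` Pow V) \<in> f ` Pow V"
    using assms(1) by (intro Max_in) auto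
  then obtain M where M: "M \<subseteq> V" "Max (f ` Pow V) = f M" by blast
  have "Max ((\<lambda>g. g M) ` F) \<in> (\<lambda>g. g M) ` F"
    using F(1,2) by (intro Max_in) auto
  then obtain g where g: "g \<in> F" "f M = g M" using F(4)[OF M(1)] by auto
  have sum_g: "(\<Sum>v\<in>X. g {v}) = g X" if "X \<subseteq> V" for X
    using F(3)[OF g(1)] that unfolding additive_on_def by simp
  show ?thesis
  proof
    show "M \<subseteq> V" by fact
    show "Max (f ` Pow V) = (\<Sum>v\<in>M. g {v})"
      using M g sum_g by simp
    show "(\<Sum>v\<in>X. g {v}) \<le> f X" if "X \<subseteq> V" for X
      using F(1) g(1) by (simp add: sum_g[OF that] F(4)[OF that])
  qed
qed

lemma bij_betw_add_mod:
  fixes i n :: nat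
  assumes "n > 0"
  shows "bij_betw (\<lambda>j. (i + j) mod n) {..<n} {..<n}"
proof -
  have "inj_on (\<lambda>j. (i + j) mod n) {..<n}"
  proof (rule linorder_inj_onI)
    fix x y assume "x < y" "x \<in> {..<n}" "y \<in> {..<n}"
    then have "\<not> n dvd y - x" by (auto dest: dvd_imp_le)
    then show "(i + x) mod n \<noteq> (i + y) mod n"
      using \<open>x < y\<close> mod_eq_dvd_iff_nat[of "i + x" "i + y" n] by auto
  qed auto
  moreover have "(\<lambda>j. (i + j) mod n) ` {..<n} \<subseteq> {..<n}"
    using assms by auto
  ultimately show ?thesis
    by (simp add: bij_betw_def endo_inj_surj)
qed

definition cyclic_window :: "(nat \<Rightarrow> 'a) \<Rightarrow> nat \<Rightarrow> nat \<Rightarrow> nat \<Rightarrow> 'a set" where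
  "cyclic_window e n b j = (\<lambda>i. e ((i + j) mod n)) ` {..<b}"

text \<open>Double counting over starts \<open>j\<close> and offsets \<open>i\<close>. For a fixed
  offset, rotating the start through all \<open>n\<close> positions visits each element of
  \<open>V\<close> once and contributes \<open>sum w M\<close>; there are \<open>b\<close>
  offsets.\<close>

lemma sum_cyclic_windows:
  fixes w :: "'a \<Rightarrow> real"
  assumes "bij_betw e {..<n} V" "M \<subseteq> V" "b \<le> n" "n > 0"
  shows "(\<Sum>j<n. sum w (M \<inter> cyclic_window e n b j)) = real b * sum w M"
proof -
  \<comment> \<open>Extending \<open>w\<close> by zero outside \<open>M\<close> turns the
    intersection with \<open>M\<close> into a sum over a fixed index range, so the two sums can be
    swapped.\<close>
  define h where "h v = (if v \<in> M then w v else 0)" for v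
  have fin: "finite V" using assms(1) bij_betw_finite by blast
  have window: "sum w (M \<inter> cyclic_window e n b j) = (\<Sum>i<b. h (e ((i + j) mod n)))" for j
  proof -
    \<comment> \<open>Since \<open>b \<le> n\<close>, a window does not wrap onto itself, so summing
      over its elements equals summing over its offsets.\<close>
    have "inj_on (\<lambda>i. (j + i) mod n) {..<b}"
      by (rule inj_on_subset[OF bij_betw_imp_inj_on[OF bij_betw_add_mod[OF assms(4)]]])
        (use assms(3) in auto)
    moreover have "inj_on e ((\<lambda>i. (j + i) mod n) ` {..<b})"
      by (rule inj_on_subset[OF bij_betw_imp_inj_on[OF assms(1)]]) (use assms(4) in auto)
    ultimately have "inj_on (e \<circ> (\<lambda>i. (j + i) mod n)) {..<b}"
      by (rule comp_inj_on)
    then have inj: "inj_on (\<lambda>i. e ((i + j) mod n)) {..<b}"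
      by (simp add: comp_def add.commute)
    have "sum w (M \<inter> cyclic_window e n b j) = sum h (cyclic_window e n b j)"
      unfolding h_def cyclic_window_def
      by (subst sum.inter_restrict[symmetric]) (auto simp: Int_commute)
    also have "\<dots> = (\<Sum>i<b. h (e ((i + j) mod n)))"
      unfolding cyclic_window_def using sum.reindex[OF inj, of h] by (simp add: comp_def)
    finally show ?thesis .
  qed
  have shift: "(\<Sum>j<n. h (e ((i + j) mod n))) = sum w M" for i
  proof -
    have "(\<Sum>j<n. h (e ((i + j) mod n))) = (\<Sum>k<n. h (e k))"
      using sum.reindex_bij_betw[OF bij_betw_add_mod[OF assms(4), of i], of "\<lambda>k. h (e k)"] by simp
    also have "\<dots> = sum h V"
      using sum.reindex_bij_betw[OF assms(1), of h] by simp
    also have "\<dots> = sum w M"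
      unfolding h_def using sum.inter_restrict[OF fin, of w M] assms(2)
      by (simp add: Int_absorb1)
    finally show ?thesis .
  qed
  show ?thesis
    unfolding window by (subst sum.swap) (simp add: shift)
qed

text \<open>The list is fixed before \<open>f\<close> is quantified: the queries are non-adaptive,
  and one list serves all XOS functions on \<open>V\<close>.\<close>

lemma query_list_exists:
  fixes V :: "'a set"
  assumes "finite V" "V \<noteq> {}"
  shows "\<exists>Qs. (\<forall>Q\<in>set Qs. Q \<subseteq> V) \<and> length Qs \<le> card V * 2 ^ b \<and>
    (b \<le> card V \<longrightarrow> (\<forall>f. xos_on V f \<longrightarrow>
      (\<exists>Q\<in>set Qs. real b * Max (f ` Pow V) \<le> real (card V) * f Q)))"
proof -
  define n where "n = card V"
  have n: "n > 0" using assms by (simp add: n_def card_gt_0_iff)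
  obtain e where e: "bij_betw e {..<n} V"
    using ex_bij_betw_nat_finite[OF assms(1)] by (auto simp: n_def atLeast0LessThan)
  define W where "W = cyclic_window e n b"
  have W_sub: "W j \<subseteq> V" for j
    using e n unfolding W_def cyclic_window_def bij_betw_def by auto
  have fin_W: "finite (W j)" for j
    by (simp add: W_def cyclic_window_def)
  have card_W: "card (W j) \<le> b" for j
    using card_image_le[of "{..<b}"] by (simp add: W_def cyclic_window_def)
  obtain Qs where Qs: "set Qs = (\<Union>j<n. Pow (W j))" "distinct Qs"
    using finite_distinct_list[of "\<Union>j<n. Pow (W j)"] fin_W by auto
  have "length Qs = card (\<Union>j<n. Pow (W j))"
    using Qs distinct_card by metis
  also have "\<dots> \<le> (\<Sum>j<n. card (Pow (W j)))"
    by (rule card_UN_le) simp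
  also have "\<dots> \<le> (\<Sum>j<n. 2 ^ b)"
    using fin_W card_W by (intro sum_mono) (simp add: card_Pow)
  finally have len: "length Qs \<le> n * 2 ^ b" by simp
  have "\<exists>Q\<in>set Qs. real b * Max (f ` Pow V) \<le> real n * f Q" if b: "b \<le> n" and xos: "xos_on V f" for f
  proof (rule ccontr)
    assume "\<not> ?thesis"
    then have less: "real n * f Q < real b * Max (f ` Pow V)" if "Q \<in> set Qs" for Q
      using that by (simp add: not_le)
    obtain M w where M: "M \<subseteq> V" "Max (f ` Pow V) = sum w M"
        "\<And>X. X \<subseteq> V \<Longrightarrow> sum w X \<le> f X"
      using xos_on_maximizer[OF assms(1) xos] by blast
    \<comment> \<open>Averaging: each \<open>M \<inter> W j\<close> is a queried subset of
      \<open>W j\<close>, so if all queries fell short, summing over the \<open>n\<close> windows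
      would make \<open>n * b * sum w M\<close> smaller than itself.\<close>
    have "real n * (real b * sum w M) = (\<Sum>j<n. real n * sum w (M \<inter> W j))"
      using sum_cyclic_windows[OF e M(1) b n, of w] by (simp add: W_def flip: sum_distrib_left)
    also have "\<dots> \<le> (\<Sum>j<n. real n * f (M \<inter> W j))"
      using M(1) by (intro sum_mono mult_left_mono M(3)) auto
    also have "\<dots> < (\<Sum>j<n. real b * sum w M)"
    proof (rule sum_strict_mono)
      show "real n * f (M \<inter> W j) < real b * sum w M" if "j \<in> {..<n}" for j
        using less[of "M \<inter> W j"] that by (auto simp: Qs(1) M(2))
    qed (use n in auto)
    finally show False by simp
  qed
  moreover have "\<forall>Q\<in>set Qs. Q \<subseteq> V"
    using Qs(1) W_sub by blast
  ultimately show ?thesis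
    using len unfolding n_def by (intro exI[of _ Qs]) simp
qed

text \<open>Rounding up costs at most a factor 2, and
  \<open>2 powr (ln n / \<epsilon>) = n powr (ln 2 / \<epsilon>)\<close>, where
  \<open>ln 2 \<le> 1\<close>.\<close>

lemma query_count_bigo:
  fixes \<epsilon> :: real
  assumes "\<epsilon> > 0"
  shows "(\<lambda>n. real (n * 2 ^ nat \<lceil>ln (real n) / \<epsilon>\<rceil>)) \<in> O(\<lambda>n. real n powr (1 / \<epsilon> + 1) * ln (real n))"
\<comment> \<open>The 2 pays for the ceiling; \<open>1 / ln 2\<close> comes from the bound
  \<open>1 \<le> ln n / ln 2\<close> for \<open>n \<ge> 2\<close>.\<close>
proof (rule bigoI[where c = "2 / ln 2"])
  show "\<forall>\<^sub>F n in sequentially. norm (real (n * 2 ^ nat \<lceil>ln (real n) / \<epsilon>\<rceil>))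
      \<le> 2 / ln 2 * norm (real n powr (1 / \<epsilon> + 1) * ln (real n))"
    using eventually_ge_at_top[of 2]
  proof eventually_elim
    case (elim n)
    have ln_n: "ln 2 \<le> ln (real n)" "ln (real n) > 0" using elim by simp_all
    have "real (nat \<lceil>ln (real n) / \<epsilon>\<rceil>) \<le> ln (real n) / \<epsilon> + 1"
      using ln_n assms by (simp add: of_nat_nat)
    then have "2 powr real (nat \<lceil>ln (real n) / \<epsilon>\<rceil>) \<le> (2::real) powr (ln (real n) / \<epsilon> + 1)"
      by (intro powr_mono) auto
    then have "2 ^ nat \<lceil>ln (real n) / \<epsilon>\<rceil> \<le> (2::real) powr (ln (real n) / \<epsilon> + 1)"
      by (simp add: powr_realpow)
    also have "\<dots> = 2 * real n powr (ln 2 / \<epsilon>)"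
      using elim by (simp add: powr_add) (simp add: powr_def mult.commute)
    also have "\<dots> \<le> 2 * real n powr (1 / \<epsilon>)"
      using elim assms ln2_le_25_over_36 by (simp add: powr_mono divide_right_mono)
    finally have "real n * 2 ^ nat \<lceil>ln (real n) / \<epsilon>\<rceil> \<le> 2 * real n powr (1 / \<epsilon> + 1)"
      using elim by (simp add: powr_add mult.commute mult.left_commute mult_left_mono)
    also have "\<dots> \<le> 2 * real n powr (1 / \<epsilon> + 1) * (ln (real n) / ln 2)"
      using mult_left_mono[of 1 "ln (real n) / ln 2" "2 * real n powr (1 / \<epsilon> + 1)"] ln_n by simp
    finally show ?case using ln_n by simp
  qed
qed

theorem theorem2:
  fixes \<epsilon> :: real
  assumes "\<epsilon> > 0"
  shows "\<exists>(A :: 'a set \<Rightarrow> ('a, 'a set) oracle_alg) (T :: nat \<Rightarrow> nat).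
    (\<lambda>n. real (T n)) \<in> O(\<lambda>n. real n powr (1 / \<epsilon> + 1) * ln (real n)) \<and>
    (\<forall>V f. finite V \<and> card V \<ge> 2 \<and> xos_on V f \<longrightarrow>
      alg_on V (A V) \<and>
      calls_at_most f (A V) (T (card V)) \<and>
      (\<epsilon> * real (card V) / ln (real (card V)) \<ge> 1 \<longrightarrow>
        approximates (\<epsilon> * real (card V) / ln (real (card V))) V f (A V)))"
proof -
  \<comment> \<open>The smallest natural number for which the ratio \<open>b / n\<close> of the
    windows reaches the target \<open>ln n / (\<epsilon> * n)\<close>.\<close>
  define b where "b n = nat \<lceil>ln (real n) / \<epsilon>\<rceil>" for n
  have "\<forall>V :: 'a set. \<exists>Qs. finite V \<and> V \<noteq> {} \<longrightarrow>
    (\<forall>Q\<in>set Qs. Q \<subseteq> V) \<and> length Qs \<le> card V * 2 ^ b (card V) \<and>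
    (b (card V) \<le> card V \<longrightarrow> (\<forall>f. xos_on V f \<longrightarrow>
      (\<exists>Q\<in>set Qs. real (b (card V)) * Max (f ` Pow V) \<le> real (card V) * f Q)))"
    (is "\<forall>V. \<exists>Qs. ?P V Qs")
  proof
    fix V :: "'a set"
    show "\<exists>Qs. ?P V Qs" by (cases "finite V \<and> V \<noteq> {}") (use query_list_exists[of V "b (card V)"] in auto)
  qed
  then obtain L :: "'a set \<Rightarrow> 'a set list" where L: "\<And>V. ?P V (L V)"
    by metis
  \<comment> \<open>An XOS function vanishes at the empty set, so the search starts with a correct
    value without spending a call.\<close>
  define A where "A V = best_query {} 0 (L V)" for V
  have "alg_on V (A V) \<and> calls_at_most f (A V) (card V * 2 ^ b (card V)) \<and>
      (\<epsilon> * real (card V) / ln (real (card V)) \<ge> 1 \<longrightarrow>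
        approximates (\<epsilon> * real (card V) / ln (real (card V))) V f (A V))"
    if V: "finite V" "card V \<ge> 2" and f: "xos_on V f" for V :: "'a set" and f
  proof (intro conjI impI)
    have ne: "V \<noteq> {}" using V by auto
    note LV = L[of V, rule_format, OF conjI[OF V(1) ne]]
    define n where "n = card V"
    have ln_n: "ln (real n) > 0" using V(2) by (simp add: n_def)
    have f0: "f {} = 0" using xos_on_empty[OF f] .
    obtain R where R: "run f (A V) = return_pmf (R, length (L V))"
        "\<forall>Q\<in>insert {} (set (L V)). f Q \<le> f R"
      using run_best_query[of f "{}" "L V"] unfolding A_def f0 by blast
    show "alg_on V (A V)"
      unfolding A_def using LV by (intro alg_on_best_query) auto
    show "calls_at_most f (A V) (card V * 2 ^ b (card V))"
      unfolding calls_at_most_def R(1) using LV by simp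
    assume "\<epsilon> * real (card V) / ln (real (card V)) \<ge> 1"
    \<comment> \<open>A ratio of at least 1 bounds \<open>ln n / \<epsilon>\<close> by the integer
      \<open>n\<close>, so its ceiling also fits and the windows do not exceed
      \<open>V\<close>.\<close>
    then have "ln (real n) / \<epsilon> \<le> real n"
      using assms ln_n by (simp add: n_def field_simps)
    then have "b n \<le> n" by (simp add: b_def nat_le_iff ceiling_le_iff)
    then obtain Q where Q: "Q \<in> set (L V)" "real (b n) * Max (f ` Pow V) \<le> real n * f Q"
      using LV f unfolding n_def by blast
    \<comment> \<open>Although \<open>f\<close> may take negative values, its maximum is at least
      \<open>f {} = 0\<close>, so rounding the factor \<open>ln n / \<epsilon>\<close> up to
      \<open>b n\<close> can only increase the product.\<close>
    have "Max (f ` Pow V) \<ge> f {}"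
      using V(1) by (intro Max_ge) auto
    then have "ln (real n) / \<epsilon> * Max (f ` Pow V) \<le> real (b n) * Max (f ` Pow V)"
      unfolding f0 b_def by (intro mult_right_mono real_nat_ceiling_ge)
    also have "\<dots> \<le> real n * f R"
      using mult_left_mono[of "f Q" "f R" "real n"] Q R(2) by auto
    finally have "1 / (\<epsilon> * real n / ln (real n)) * Max (f ` Pow V) \<le> f R"
      using assms V(2) ln_n by (simp add: n_def field_simps)
    then show "approximates (\<epsilon> * real (card V) / ln (real (card V))) V f (A V)"
      by (simp add: approximates_def output_pmf_def R(1) n_def)
  qed
  moreover have "(\<lambda>n. real (n * 2 ^ b n)) \<in> O(\<lambda>n. real n powr (1 / \<epsilon> + 1) * ln (real n))"
    unfolding b_def using query_count_bigo[OF assms] .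
  ultimately show ?thesis
    by (intro exI[of _ A] exI[of _ "\<lambda>n. n * 2 ^ b n"] conjI allI impI) auto
qed

end
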